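(* For every crown $c$ and every integer $k\ge 0$, row $k$ of the crown triangle $\mathcal{T}_c$ forms a Collatz chain of length $2k+1$: $$\mathcal{T}_c(k,0)\to\mathcal{T}_c(k,1)\to\cdots\to\mathcal{T}_c(k,2k),$$ i.e. the finite sequence $(\mathcal{T}_c(k,0),\mathcal{T}_c(k,1),\dots,\mathcal{T}_c(k,2k))$ is a Collatz chain.
   Context: The Collatz function is $C(n)=n/2$ if $n$ is even and $C(n)=3n+1$ if $n$ is odd. A Collatz chain is a finite sequence $(n_0,n_1,\dots,n_m)$ of nonnegative integers with $C(n_i)=n_{i+1}$ for $0\le i<m$, with $n_i$ and $n_{i+1}$ of opposite parity for all such $i$, and which is maximal in the sense that extending the sequence by one step in either direction (appending $C(n_m)$, or prepending a nonnegative integer $n_{-1}$ with $C(n_{-1})=n_0$) would violate the parity alternation property. Its length is its number of terms, $m+1$. A nonnegative integer $c$ is a crown if $c\equiv 0$ or $8\pmod{12}$. For a crown $c$ put $\lambda=(c+2)/2$. For integers $k\ge 0$ and $0\le j\le 2k$ define $R(k,j)=2^{k-\lfloor j/2\rfloor}\cdot 3^{\lfloor j/2\rfloor}$. Let $g(j)=2$ if $j$ is even and $g(j)=1$ if $j$ is odd. The crown triangle $\mathcal{T}_c$ has the element $\mathcal{T}_c(k,j)=g(j)\,(\lambda R(k,j)-1)$ at position $(k,j)$; row $k$ consists of the positions $j=0,1,\dots,2k$. *)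

theory Defs imports Main begin

definition collatz :: "nat \<Rightarrow> nat" where
  "collatz n = (if even n then n div 2 else 3 * n + 1)"

definition collatz_sequence :: "nat list \<Rightarrow> bool" where
  "collatz_sequence xs \<longleftrightarrow> xs \<noteq> [] \<and> successively (\<lambda>a b. collatz a = b) xs"

definition parity_alternating :: "nat list \<Rightarrow> bool" where
  "parity_alternating xs \<longleftrightarrow> successively (\<lambda>a b. even a \<noteq> even b) xs"

text \<open>
  Maximality is vacuously satisfied on the left if the first term has no Collatz
  predecessor at all; a successor always exists.
\<close>

definition collatz_chain :: "nat list \<Rightarrow> bool" where
  "collatz_chain xs \<longleftrightarrow>
     collatz_sequence xs \<and> parity_alternating xs \<and>
     \<not> parity_alternating (xs @ [collatz (last xs)]) \<and>
     (\<forall>p. collatz p = hd xs \<longrightarrow> \<not> parity_alternating (p # xs))"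

definition crown :: "nat \<Rightarrow> bool" where
  "crown c \<longleftrightarrow> c mod 12 = 0 \<or> c mod 12 = 8"

text \<open>The division is exact for crowns, which are even.\<close>

definition crown_lambda :: "nat \<Rightarrow> nat" where
  "crown_lambda c = (c + 2) div 2"

text \<open>Only used for \<open>j \<le> 2 * k\<close>, where the subtraction in the exponent does not truncate.\<close>

definition crown_R :: "nat \<Rightarrow> nat \<Rightarrow> nat" where
  "crown_R k j = 2 ^ (k - j div 2) * 3 ^ (j div 2)"

definition crown_g :: "nat \<Rightarrow> nat" where
  "crown_g j = (if even j then 2 else 1)"

text \<open>The subtraction does not truncate, since \<open>crown_lambda c\<close> and \<open>crown_R k j\<close> are positive.\<close>

definition crown_triangle :: "nat \<Rightarrow> nat \<Rightarrow> nat \<Rightarrow> nat" where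
  "crown_triangle c k j = crown_g j * (crown_lambda c * crown_R k j - 1)"

definition crown_row :: "nat \<Rightarrow> nat \<Rightarrow> nat list" where
  "crown_row c k = map (crown_triangle c k) [0..<2 * k + 1]"

end

theory Submission imports Defs begin

text \<open>
  The proof rests on two facts about \<open>\<lambda> = (c + 2) / 2\<close>: a number \<open>c\<close> is a crown only if \<open>\<lambda>\<close> is
  divisible neither by 2 nor by 3.

  For \<open>i < k\<close> put \<open>A = \<lambda> * 2 ^ (k - i) * 3 ^ i\<close>. The positions \<open>2 * i\<close> and \<open>2 * i + 1\<close> of row \<open>k\<close>
  carry \<open>2 * (A - 1)\<close> and \<open>A - 1\<close>, so halving leads from the first to the second. Since \<open>A\<close> is
  even, \<open>A - 1\<close> is odd and is sent to \<open>3 * (A - 1) + 1 = 2 * (3 * A / 2 - 1)\<close>, the entry at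
  position \<open>2 * i + 2\<close>: one factor 2 of \<open>A\<close> has been traded for a factor 3.

  At the right end all factors 2 are used up: the last entry \<open>2 * (\<lambda> * 3 ^ k - 1)\<close> is sent to
  \<open>\<lambda> * 3 ^ k - 1\<close>, which is even because \<open>\<lambda>\<close> is odd. At the left end the entry
  \<open>2 * (\<lambda> * 2 ^ k - 1)\<close> is even, so only an odd predecessor \<open>p\<close> could be prepended; it would satisfy
  \<open>3 * (p + 1) = \<lambda> * 2 ^ (k + 1)\<close>, which is impossible because 3 does not divide \<open>\<lambda>\<close>.
\<close>

lemma crown_lambda_coprime_6:
  assumes "crown c"
  shows "odd (crown_lambda c)" "\<not> 3 dvd crown_lambda c"
  using assms unfolding crown_def crown_lambda_def by presburger+

lemma crown_lambda_pos: "crown_lambda c > 0"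
  unfolding crown_lambda_def by simp

lemma crown_triangle_even_position:
  "crown_triangle c k (2 * i) = 2 * (crown_lambda c * 2 ^ (k - i) * 3 ^ i - 1)"
  by (simp add: crown_triangle_def crown_g_def crown_R_def mult.assoc)

lemma crown_triangle_odd_position:
  "crown_triangle c k (Suc (2 * i)) = crown_lambda c * 2 ^ (k - i) * 3 ^ i - 1"
  by (simp add: crown_triangle_def crown_g_def crown_R_def mult.assoc)

lemma odd_crown_triangle_odd_position:
  assumes "i < k"
  shows "odd (crown_triangle c k (Suc (2 * i)))"
proof -
  have "crown_lambda c * 2 ^ (k - i) * 3 ^ i > 0"
    using crown_lambda_pos by simp
  then show ?thesis
    using assms by (simp add: crown_triangle_odd_position)
qed

text \<open>
  In terms of \<open>B = \<lambda> * 2 ^ (k - i - 1) * 3 ^ i\<close> the step from an odd position reads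
  \<open>3 * (2 * B - 1) + 1 = 2 * (3 * B - 1)\<close>.
\<close>

lemma collatz_crown_triangle_odd_position:
  assumes "i < k"
  shows "collatz (crown_triangle c k (Suc (2 * i))) = crown_triangle c k (2 * Suc i)"
proof -
  define B where "B = crown_lambda c * 2 ^ (k - Suc i) * 3 ^ i"
  have "B > 0"
    using crown_lambda_pos by (simp add: B_def)
  have "k - i = Suc (k - Suc i)"
    using assms by simp
  then have "crown_triangle c k (Suc (2 * i)) = 2 * B - 1"
    unfolding crown_triangle_odd_position by (simp add: B_def)
  moreover have "crown_triangle c k (2 * Suc i) = 2 * (3 * B - 1)"
    unfolding crown_triangle_even_position by (simp add: B_def mult.left_commute)
  ultimately show ?thesis
    using odd_crown_triangle_odd_position[OF assms, of c] \<open>B > 0\<close>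
    by (simp add: collatz_def)
qed

lemma crown_triangle_step:
  assumes "j < 2 * k"
  shows "collatz (crown_triangle c k j) = crown_triangle c k (Suc j)"
    and "even (crown_triangle c k j) \<noteq> even (crown_triangle c k (Suc j))"
proof -
  have "collatz (crown_triangle c k j) = crown_triangle c k (Suc j) \<and>
    even (crown_triangle c k j) \<noteq> even (crown_triangle c k (Suc j))"
  proof (cases "even j")
    case True
    then obtain i where j: "j = 2 * i" ..
    then have "i < k"
      using assms by simp
    then show ?thesis
      using odd_crown_triangle_odd_position[of i k c]
      by (simp add: j collatz_def crown_triangle_even_position crown_triangle_odd_position)
  next
    case False
    then obtain i where j: "j = Suc (2 * i)"
      by (auto elim: oddE)
    then have "i < k"
      using assms by simp
    then show ?thesis
      using odd_crown_triangle_odd_position[of i k c]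
        collatz_crown_triangle_odd_position[of i k c] crown_triangle_even_position[of c k "Suc i"]
      by (simp add: j)
  qed
  then show "collatz (crown_triangle c k j) = crown_triangle c k (Suc j)"
    and "even (crown_triangle c k j) \<noteq> even (crown_triangle c k (Suc j))"
    by blast+
qed

text \<open>
  This is the maximality on the right: no factor 2 is left in \<open>\<lambda> * 3 ^ k\<close>, so half of the last
  entry is one less than an odd number.
\<close>

lemma even_collatz_last_entry:
  assumes "crown c"
  shows "even (collatz (crown_triangle c k (2 * k)))"
  using crown_lambda_coprime_6(1)[OF assms]
  by (simp add: collatz_def crown_triangle_even_position)

text \<open>
  This is the maximality on the left: an odd predecessor would make the first entry congruent to 1
  modulo 3, and hence \<open>\<lambda> * 2 ^ (k + 1)\<close> a multiple of 3.
\<close>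

lemma even_predecessor_first_entry:
  assumes "crown c" and p: "collatz p = crown_triangle c k 0"
  shows "even p"
proof (rule ccontr)
  assume "odd p"
  moreover have "crown_triangle c k 0 = 2 * (crown_lambda c * 2 ^ k - 1)"
    using crown_triangle_even_position[of c k 0] by simp
  moreover have "crown_lambda c * 2 ^ k > 0"
    using crown_lambda_pos by simp
  ultimately have "3 * (p + 1) = crown_lambda c * 2 ^ Suc k"
    using p by (simp add: collatz_def)
  then have "3 dvd crown_lambda c * 2 ^ Suc k"
    by (metis dvd_triv_left)
  moreover have "coprime (3 :: nat) (2 ^ Suc k)"
    by (simp only: coprime_power_right_iff coprime_right_2_iff_odd) simp
  ultimately have "3 dvd crown_lambda c"
    using coprime_dvd_mult_left_iff by blast
  then show False
    using crown_lambda_coprime_6(2)[OF assms(1)] by contradiction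
qed

lemma successively_map_upt:
  assumes "\<And>j. Suc j < n \<Longrightarrow> P (f j) (f (Suc j))"
  shows "successively P (map f [0..<n])"
  using assms by (simp add: successively_conv_nth)

theorem corollary2p12:
  fixes c k :: nat
  assumes "crown c"
  shows "collatz_chain (crown_row c k) \<and> length (crown_row c k) = 2 * k + 1"
proof -
  have ends: "crown_row c k \<noteq> []" "hd (crown_row c k) = crown_triangle c k 0"
    "last (crown_row c k) = crown_triangle c k (2 * k)"
    by (simp_all add: crown_row_def hd_map last_map hd_append)
  have ends_even: "even (crown_triangle c k 0)" "even (crown_triangle c k (2 * k))"
    using crown_triangle_even_position[of c k 0] crown_triangle_even_position[of c k k]
    by simp_all
  have "collatz_sequence (crown_row c k)"
    unfolding collatz_sequence_def crown_row_def
    by (auto intro!: successively_map_upt crown_triangle_step(1) simp del: upt_Suc)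
  moreover have "parity_alternating (crown_row c k)"
    unfolding parity_alternating_def crown_row_def
    by (rule successively_map_upt) (rule crown_triangle_step(2), simp)
  moreover have "\<not> parity_alternating (crown_row c k @ [collatz (last (crown_row c k))])"
    using even_collatz_last_entry[OF assms, of k] ends ends_even
    by (simp add: parity_alternating_def successively_append_iff)
  moreover have "\<not> parity_alternating (p # crown_row c k)"
    if "collatz p = hd (crown_row c k)" for p
    using even_predecessor_first_entry[OF assms, of p k] that ends ends_even
    by (simp add: parity_alternating_def successively_Cons)
  ultimately show ?thesis
    by (simp add: collatz_chain_def) (simp add: crown_row_def)
qed

end
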